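(* Let $V$ be a discrete valuation ring with maximal ideal $\pi V$, fraction field $K$ and finite residue field $V/\pi V\cong\mathbb{F}_q$, let $n\ge 2$, and let $$F(x)=\frac{H(x)\,\theta(x)^q}{\pi^q}\in K[x]$$ be the polynomial constructed in the context. Then $F$ is properly integral over $\mathrm{Int}_K(M_n(V))$; that is, $F$ lies in the integral closure of $\mathrm{Int}_K(M_n(V))$ but $F\notin \mathrm{Int}_K(M_n(V))$.
   Context: $\mathrm{Int}_K(M_n(V))=\{f\in K[x]\mid f(M_n(V))\subseteq M_n(V)\}$, where $M_n(V)$ is the ring of $n\times n$ matrices over $V$ and evaluation takes place in $M_n(K)$. Its integral closure is taken in its fraction field $K(x)$ (and is contained in $K[x]$). A polynomial $f\in K[x]$ is called properly integral over $\mathrm{Int}_K(M_n(V))$ if $f$ lies in the integral closure of $\mathrm{Int}_K(M_n(V))$ but $f\notin\mathrm{Int}_K(M_n(V))$. Construction of $F$. Fix a representative in $V$ for each element of the residue field $\mathbb{F}_q$; write $\mathbb{F}_q$ also for this set of representatives and $\mathbb{F}_q^\times$ for the representatives of the nonzero residue classes. Let $\mathscr{P}$ be the set of monic irreducible polynomials $f\in\mathbb{F}_q[x]$ with $2\le\deg f\le n$; for each of them fix a monic lift of the same degree in $V[x]$, denoted by the same symbol. Put $$\theta(x)=\prod_{f\in\mathscr{P}}f(x)^{\lfloor n/\deg f\rfloor},\quad h(x)=x^{n-1}\prod_{a\in\mathbb{F}_q^\times}(x^n+\pi a),\quad H(x)=\prod_{b\in\mathbb{F}_q}h(x-b),\quad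 F(x)=\frac{H(x)\,\theta(x)^q}{\pi^q},$$ where all products are computed in $V[x]$ using the chosen representatives and lifts. *)

theory Defs
  imports
    "HOL-Library.Cardinality"
    "HOL-Algebra.Subrings"
    "HOL-Algebra.Ring_Divisibility"
    "HOL-Computational_Algebra.Computational_Algebra"
    "Jordan_Normal_Form.Matrix"
    "Jordan_Normal_Form.VS_Connect"
begin

abbreviation ring_on :: "'k::field set \<Rightarrow> 'k ring" where
  "ring_on V \<equiv> (class_ring :: 'k ring)\<lparr>carrier := V\<rparr>"

text \<open>The subset \<open>V\<close> of the field \<open>K = UNIV\<close> is a discrete valuation ring (a local principal
  ideal domain that is not a field) with maximal ideal \<open>\<pi>V\<close> and fraction field \<open>K\<close>.\<close>

definition dvr_with_fraction_field :: "'k::field set \<Rightarrow> 'k \<Rightarrow> bool" where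
  "dvr_with_fraction_field V \<pi> \<longleftrightarrow>
     subring V class_ring \<and>
     principal_domain (ring_on V) \<and>
     \<pi> \<in> V \<and> \<pi> \<noteq> 0 \<and>
     (\<forall>M. maximalideal M (ring_on V) \<longleftrightarrow> M = PIdl\<^bsub>ring_on V\<^esub> \<pi>) \<and>
     (\<forall>x. \<exists>a\<in>V. \<exists>b\<in>V. b \<noteq> 0 \<and> x = a / b)"

text \<open>A surjective ring homomorphism from \<open>V\<close> with kernel \<open>\<pi>V\<close>, identifying the residue field
  \<open>V/\<pi>V\<close> with the finite field \<open>'f\<close> of \<open>q = CARD('f)\<close> elements. Values of \<open>res\<close> outside \<open>V\<close> are
  irrelevant.\<close>

definition residue_map :: "'k::field set \<Rightarrow> 'k \<Rightarrow> ('k \<Rightarrow> 'f::{finite,field}) \<Rightarrow> bool" where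
  "residue_map V \<pi> res \<longleftrightarrow>
     res \<in> Ring.ring_hom (ring_on V) (class_ring :: 'f ring) \<and>
     res ` V = UNIV \<and>
     {v \<in> V. res v = 0} = PIdl\<^bsub>ring_on V\<^esub> \<pi>"

definition polys_over :: "'k::field set \<Rightarrow> 'k poly set" where
  "polys_over V = {f. \<forall>i. coeff f i \<in> V}"

definition mats_over :: "'k::field set \<Rightarrow> nat \<Rightarrow> 'k mat set" where
  "mats_over V n = {A \<in> carrier_mat n n. elements_mat A \<subseteq> V}"

text \<open>\<open>f(A)\<close> for a square matrix \<open>A\<close>, written out entrywise.\<close>

definition poly_mat :: "'k::field poly \<Rightarrow> 'k mat \<Rightarrow> 'k mat" where
  "poly_mat f A = mat (dim_row A) (dim_row A)
     (\<lambda>(i, j). \<Sum>k\<le>degree f. coeff f k * (A ^\<^sub>m k) $$ (i, j))"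

definition Int_mat :: "'k::field set \<Rightarrow> nat \<Rightarrow> 'k poly set" where
  "Int_mat V n = {f. \<forall>A\<in>mats_over V n. poly_mat f A \<in> mats_over V n}"

text \<open>The integral closure of a subring \<open>R\<close> in the whole ring \<open>'a\<close>.\<close>

definition integral_closure :: "'a::comm_ring_1 set \<Rightarrow> 'a set" where
  "integral_closure R =
     {z. \<exists>p. lead_coeff p = 1 \<and> (\<forall>i. coeff p i \<in> R) \<and> poly p z = 0}"

text \<open>The field \<open>K(x)\<close> is \<open>'k poly fract\<close>.\<close>

definition properly_integral :: "'k::field set \<Rightarrow> nat \<Rightarrow> 'k poly \<Rightarrow> bool" where
  "properly_integral V n f \<longleftrightarrow>
     to_fract f \<in> integral_closure (to_fract ` Int_mat V n) \<and> f \<notin> Int_mat V n"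

definition representatives :: "'k::field set \<Rightarrow> ('k \<Rightarrow> 'f) \<Rightarrow> ('f \<Rightarrow> 'k) \<Rightarrow> bool" where
  "representatives V res rep \<longleftrightarrow> (\<forall>c. rep c \<in> V \<and> res (rep c) = c)"

definition irreds :: "nat \<Rightarrow> 'f::{finite,field} poly set" where
  "irreds n = {f. lead_coeff f = 1 \<and> Factorial_Ring.irreducible f \<and> 2 \<le> degree f \<and> degree f \<le> n}"

definition monic_lifts ::
  "'k::field set \<Rightarrow> ('k \<Rightarrow> 'f::{finite,field}) \<Rightarrow> nat \<Rightarrow> ('f poly \<Rightarrow> 'k poly) \<Rightarrow> bool" where
  "monic_lifts V res n lft \<longleftrightarrow>
     (\<forall>f\<in>irreds n. lft f \<in> polys_over V \<and> lead_coeff (lft f) = 1 \<and>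
        degree (lft f) = degree f \<and> map_poly res (lft f) = f)"

definition theta_poly :: "nat \<Rightarrow> ('f::{finite,field} poly \<Rightarrow> 'k::field poly) \<Rightarrow> 'k poly" where
  "theta_poly n lft = (\<Prod>f\<in>irreds n. lft f ^ (n div degree f))"

definition h_poly :: "nat \<Rightarrow> 'k::field \<Rightarrow> ('f::{finite,field} \<Rightarrow> 'k) \<Rightarrow> 'k poly" where
  "h_poly n \<pi> rep = monom 1 (n - 1) * (\<Prod>a\<in>UNIV - {0}. monom 1 n + [:\<pi> * rep a:])"

definition H_poly :: "nat \<Rightarrow> 'k::field \<Rightarrow> ('f::{finite,field} \<Rightarrow> 'k) \<Rightarrow> 'k poly" where
  "H_poly n \<pi> rep = (\<Prod>b\<in>UNIV. pcompose (h_poly n \<pi> rep) [:- rep b, 1:])"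

definition F_poly ::
  "nat \<Rightarrow> 'k::field \<Rightarrow> ('f::{finite,field} \<Rightarrow> 'k) \<Rightarrow> ('f poly \<Rightarrow> 'k poly) \<Rightarrow> 'k poly" where
  "F_poly n \<pi> rep lft =
     smult (1 / \<pi> ^ CARD('f)) (H_poly n \<pi> rep * theta_poly n lft ^ CARD('f))"

end

theory Submission
  imports Defs "Jordan_Normal_Form.Jordan_Normal_Form"
begin

text \<open>Let \<open>q\<close> be the number of elements of the residue field. A polynomial is integer-valued on
  matrices as soon as it lies in \<open>V[x] + \<chi> K[x]\<close> for every monic \<open>\<chi>\<close> of degree \<open>n\<close> over \<open>V\<close>,
  since by the Cayley-Hamilton theorem \<open>f(A)\<close> depends only on \<open>f\<close> modulo the characteristic
  polynomial of \<open>A\<close> (\<open>in_Int_mat_if_integral_mod\<close>). So all computations take place in \<open>K[x]\<close>,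
  modulo a given \<open>\<chi>\<close>.

  If the reduction of \<open>\<chi>\<close> modulo \<open>\<pi>\<close> is not of the form \<open>(x - b)\<^sup>n\<close>, then no linear factor has
  multiplicity \<open>n\<close>, and \<open>H \<theta>\<^sup>q\<close> can be regrouped into \<open>q\<close> factors that are each divisible by \<open>\<chi>\<close>
  modulo \<open>\<pi>\<close>. Hence \<open>F\<close> is already in \<open>V[x] + \<chi> K[x]\<close> (\<open>F_integral_mod_not_linear_power\<close>). The
  denominator is critical only when \<open>\<chi>\<close> reduces to \<open>(x - b)\<^sup>n\<close>. Then \<open>F\<close> need not lie in the
  ring \<open>S = V[x] + \<chi> K[x]\<close>, but it satisfies a monic quadratic equation over \<open>S\<close>, and \<open>\<pi>\<close> and
  \<open>x - b\<close> multiply it into \<open>S\<close> (\<open>linear_power_case\<close>).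

  The equations found in this way depend on \<open>\<chi>\<close>. To obtain one that does not, observe that
  modulo \<open>\<pi>\<close> and \<open>x - b\<close> their coefficients can only take \<open>q\<close> values. So with \<open>Q(T)\<close> the product
  of the \<open>q\<^sup>2\<close> quadratics \<open>T\<^sup>2 + c T + d\<close>, where \<open>c\<close> and \<open>d\<close> run through the representatives of
  the residue field, \<open>Q(F)\<close> lies in \<open>S\<close> for every \<open>\<chi>\<close> (\<open>prod_quadratics\<close>), that is, \<open>Q(F)\<close> is
  integer-valued. Therefore \<open>F\<close> is a root of \<open>Q(T) - Q(F)\<close>, which is monic with integer-valued
  coefficients (\<open>F_integral\<close>).

  On the other hand \<open>F\<close> is not integer-valued: the upper right entry of \<open>F\<close> at the Jordan block
  of size \<open>n\<close> with the representative of \<open>0\<close> as eigenvalue is a unit divided by \<open>\<pi>\<close>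
  (\<open>F_not_in_Int_mat\<close>).\<close>

section \<open>Subrings and products of monic quadratics\<close>

locale unital_subring =
  fixes S :: "'a::comm_ring_1 set"
  assumes one [simp, intro]: "1 \<in> S"
    and diff [intro]: "x \<in> S \<Longrightarrow> y \<in> S \<Longrightarrow> x - y \<in> S"
    and mult [intro]: "x \<in> S \<Longrightarrow> y \<in> S \<Longrightarrow> x * y \<in> S"
begin

lemma zero [simp, intro]: "0 \<in> S"
  using diff[OF one one] by simp

lemma uminus [intro]: "x \<in> S \<Longrightarrow> - x \<in> S"
  using diff[OF zero] by fastforce

lemma add [intro]: "x \<in> S \<Longrightarrow> y \<in> S \<Longrightarrow> x + y \<in> S"
  using diff[OF _ uminus] by fastforce

lemma power [intro]: "x \<in> S \<Longrightarrow> x ^ k \<in> S"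
  by (induction k) auto

lemma sum [intro]: "(\<And>i. i \<in> I \<Longrightarrow> f i \<in> S) \<Longrightarrow> sum f I \<in> S"
  by (induction I rule: infinite_finite_induct) auto

lemma prod [intro]: "(\<And>i. i \<in> I \<Longrightarrow> f i \<in> S) \<Longrightarrow> prod f I \<in> S"
  by (induction I rule: infinite_finite_induct) auto

text \<open>The elements of \<open>S\<close> that multiply \<open>y\<close> into \<open>S\<close> form an ideal \<open>I\<close> of \<open>S\<close>, and \<open>approx\<close> says
  that finitely many elements \<open>r c\<close> represent all classes of \<open>S / I\<close>. As \<open>y\<close> is a root of a
  monic quadratic over \<open>S\<close>, the module \<open>M = S + S y\<close> is a ring, and \<open>I M \<subseteq> S\<close>. Adjusting the
  coefficients of the quadratic by elements of \<open>I\<close> shows that one of the finitely many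
  quadratics below takes a value in \<open>I\<close> at \<open>y\<close>; all others take values in \<open>M\<close>, so the product is
  in \<open>I M\<close>. The quadratics themselves do not depend on \<open>S\<close> and \<open>y\<close>: their product serves all
  matrices at once.\<close>

lemma prod_quadratics:
  fixes r :: "'c::finite \<Rightarrow> 'a"
  assumes r: "\<And>c. r c \<in> S"
    and approx: "\<And>s. s \<in> S \<Longrightarrow> \<exists>c. (s - r c) * y \<in> S"
    and u: "u \<in> S" "y\<^sup>2 + u * y \<in> S"
  shows "(\<Prod>(c, d)\<in>UNIV. y\<^sup>2 + r c * y + r d) \<in> S"
proof -
  define M where "M = {s + t * y | s t. s \<in> S \<and> t \<in> S}"
  have M_I: "s + t * y \<in> M" if "s \<in> S" "t \<in> S" for s t
    using that by (auto simp: M_def)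
  interpret M: unital_subring M
  proof
    show "1 \<in> M" using M_I[of 1 0] by simp
  next
    fix v w assume "v \<in> M" "w \<in> M"
    then obtain s t s' t' where *: "v = s + t * y" "w = s' + t' * y"
      "s \<in> S" "t \<in> S" "s' \<in> S" "t' \<in> S" by (auto simp: M_def)
    have "v - w = (s - s') + (t - t') * y" unfolding * by (simp add: algebra_simps)
    also have "\<dots> \<in> M" using * by (intro M_I diff)
    finally show "v - w \<in> M" .
    have "v * w = (s * s' + t * t' * (y\<^sup>2 + u * y)) + (s * t' + t * s' - t * t' * u) * y"
      unfolding * by (simp add: algebra_simps power2_eq_square)
    moreover have "s * s' + t * t' * (y\<^sup>2 + u * y) \<in> S" "s * t' + t * s' - t * t' * u \<in> S"
      using * u by blast+
    ultimately show "v * w \<in> M" using M_I by metis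
  qed
  have yM: "y \<in> M" using M_I[of 0 1] by simp
  have SM: "s \<in> M" if "s \<in> S" for s using M_I[of s 0] that by simp
  \<comment> \<open>Replace first the linear and then the constant coefficient by a representative.\<close>
  obtain c where c: "(u - r c) * y \<in> S" using approx u by blast
  define s where "s = - (y\<^sup>2 + r c * y)"
  have "s = (u - r c) * y - (y\<^sup>2 + u * y)" by (simp add: s_def algebra_simps)
  then have s: "s \<in> S" using c u by (simp add: diff)
  then obtain d where d: "(s - r d) * y \<in> S" using approx by blast
  define e where "e = y\<^sup>2 + r c * y + r d"
  have "e = - (s - r d)" by (simp add: e_def s_def)
  moreover from this have "e * y = - ((s - r d) * y)" by (simp only: minus_mult_left)
  ultimately have e: "e \<in> S" "e * y \<in> S" using d s r by (metis diff uminus)+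
  let ?q = "\<lambda>(c, d). y\<^sup>2 + r c * y + r d"
  have "(\<Prod>x\<in>UNIV. ?q x) = ?q (c, d) * (\<Prod>x\<in>UNIV - {(c, d)}. ?q x)"
    by (rule prod.remove) auto
  moreover have "(\<Prod>x\<in>UNIV - {(c, d)}. ?q x) \<in> M"
    by (rule M.prod, unfold split_def, intro M.add M.mult M.power yM SM r)
  then obtain a b where ab: "(\<Prod>x\<in>UNIV - {(c, d)}. ?q x) = a + b * y" "a \<in> S" "b \<in> S"
    by (auto simp: M_def)
  ultimately have "(\<Prod>x\<in>UNIV. ?q x) = e * a + b * (e * y)"
    by (simp add: e_def algebra_simps)
  then show ?thesis using e ab by (simp add: add mult)
qed

lemma unital_subring_polys: "unital_subring {f :: 'a poly. \<forall>i. coeff f i \<in> S}"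
  by unfold_locales (auto simp: coeff_mult coeff_pCons one_pCons split: nat.split)

end

lemma in_mats_over_iff:
  "A \<in> mats_over V n \<longleftrightarrow> A \<in> carrier_mat n n \<and> (\<forall>i<n. \<forall>j<n. A $$ (i, j) \<in> V)"
  by (auto simp: mats_over_def dest: elements_matD)

section \<open>Polynomials in a matrix\<close>

definition poly_entry :: "'k::field mat \<Rightarrow> nat \<Rightarrow> nat \<Rightarrow> 'k poly \<Rightarrow> 'k" where
  "poly_entry A i j f = (\<Sum>k\<le>degree f. coeff f k * (A ^\<^sub>m k) $$ (i, j))"

lemma poly_mat_entry:
  "A \<in> carrier_mat n n \<Longrightarrow> i < n \<Longrightarrow> j < n \<Longrightarrow> poly_mat f A $$ (i, j) = poly_entry A i j f"
  by (auto simp: poly_mat_def poly_entry_def)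

lemma poly_entry_bound:
  assumes "degree f \<le> N"
  shows "poly_entry A i j f = (\<Sum>k\<le>N. coeff f k * (A ^\<^sub>m k) $$ (i, j))"
  unfolding poly_entry_def using assms
  by (intro sum.mono_neutral_left) (auto simp: coeff_eq_0)

lemma poly_entry_0 [simp]: "poly_entry A i j 0 = 0"
  by (simp add: poly_entry_def)

lemma poly_entry_add [simp]: "poly_entry A i j (f + g) = poly_entry A i j f + poly_entry A i j g"
proof -
  let ?N = "max (degree f) (degree g)"
  show ?thesis
    using poly_entry_bound[of "f + g" ?N] poly_entry_bound[of f ?N] poly_entry_bound[of g ?N]
    by (simp add: degree_add_le sum.distrib distrib_right)
qed

lemma poly_entry_smult [simp]: "poly_entry A i j (smult c f) = c * poly_entry A i j f"
  using poly_entry_bound[of "smult c f" "degree f" A i j]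
  by (simp add: poly_entry_def sum_distrib_left mult.assoc)

lemma poly_entry_sum: "poly_entry A i j (sum f I) = (\<Sum>x\<in>I. poly_entry A i j (f x))"
  by (induction I rule: infinite_finite_induct) auto

lemma poly_entry_const [simp]: "poly_entry A i j [:c:] = c * (1\<^sub>m (dim_row A)) $$ (i, j)"
  by (simp add: poly_entry_def)

lemma poly_entry_shift:
  assumes A: "A \<in> carrier_mat n n" and ij: "i < n" "j < n"
  shows "poly_entry A i j (pCons 0 g) = (\<Sum>l<n. poly_entry A i l g * A $$ (l, j))"
proof -
  have *: "(A ^\<^sub>m Suc k) $$ (i, j) = (\<Sum>l<n. (A ^\<^sub>m k) $$ (i, l) * A $$ (l, j))" for k
    using A ij pow_carrier_mat[OF A, of k]
    by (auto simp: scalar_prod_def times_mat_def atLeast0LessThan simp del: pow_carrier_mat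
        intro!: sum.cong)
  have "poly_entry A i j (pCons 0 g)
      = (\<Sum>k\<le>Suc (degree g). coeff (pCons 0 g) k * (A ^\<^sub>m k) $$ (i, j))"
    by (rule poly_entry_bound) (simp add: degree_pCons_le)
  also have "\<dots> = (\<Sum>k\<le>degree g. coeff g k * (A ^\<^sub>m Suc k) $$ (i, j))"
    by (subst sum.atMost_Suc_shift) simp
  also have "\<dots> = (\<Sum>k\<le>degree g. \<Sum>l<n. coeff g k * (A ^\<^sub>m k) $$ (i, l) * A $$ (l, j))"
    unfolding * by (simp add: sum_distrib_left mult.assoc)
  also have "\<dots> = (\<Sum>l<n. poly_entry A i l g * A $$ (l, j))"
    by (subst sum.swap) (simp add: poly_entry_def sum_distrib_right)
  finally show ?thesis .
qed

text \<open>The map that sends a column \<open>(p\<^sub>0, \<dots>)\<close> of polynomials to \<open>\<Sum>l. p\<^sub>l(A) e\<^sub>l\<close> kills every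
  polynomial multiple of a column of \<open>x I - A\<close>. By the adjugate identity, \<open>char_poly A * g\<close>
  times the unit column \<open>e\<^sub>j\<close> is a combination of such multiples. The multiples \<open>g\<close> are included
  so that the value of a polynomial at \<open>A\<close> depends only on its class modulo \<open>char_poly A\<close>.\<close>

lemma Cayley_Hamilton_multiple:
  assumes A: "A \<in> carrier_mat n n" and ij: "i < n" "j < n"
  shows "poly_entry A i j (char_poly A * g) = 0"
proof -
  let ?X = "char_poly_matrix A"
  have X: "?X \<in> carrier_mat n n" using A by simp
  have X_entry: "?X $$ (l, m) = [:- A $$ (l, m), if l = m then 1 else 0:]" if "l < n" "m < n" for l m
    using A that by (auto simp: char_poly_matrix_def)
  define B where "B m = adj_mat ?X $$ (m, j) * g" for m
  have col: "(if l = j then char_poly A * g else 0) = (\<Sum>m<n. B m * ?X $$ (l, m))"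
    if l: "l < n" for l
  proof -
    have "(?X * adj_mat ?X) $$ (l, j) = (\<Sum>m<n. ?X $$ (l, m) * adj_mat ?X $$ (m, j))"
      using adj_mat(1)[OF X] X l ij
      by (auto simp: scalar_prod_def times_mat_def atLeast0LessThan intro!: sum.cong)
    also have "(?X * adj_mat ?X) $$ (l, j) = (if l = j then char_poly A else 0)"
      using adj_mat(2)[OF X] l ij by (simp add: char_poly_def)
    finally have "(if l = j then char_poly A else 0) * g
        = (\<Sum>m<n. ?X $$ (l, m) * adj_mat ?X $$ (m, j)) * g" by (rule arg_cong)
    also have "\<dots> = (\<Sum>m<n. B m * ?X $$ (l, m))"
      unfolding sum_distrib_right B_def by (intro sum.cong refl) (simp add: mult_ac)
    finally show ?thesis by (simp split: if_splits)
  qed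
  have B_entry: "poly_entry A i l (B m * ?X $$ (l, m))
      = (if l = m then poly_entry A i m (pCons 0 (B m)) else 0) - poly_entry A i l (B m) * A $$ (l, m)"
    if "l < n" "m < n" for l m
  proof -
    have "B m * ?X $$ (l, m) = smult (- A $$ (l, m)) (B m) + (if l = m then pCons 0 (B m) else 0)"
      unfolding X_entry[OF that] by simp
    then show ?thesis by (auto simp del: smult_minus_left)
  qed
  have "poly_entry A i j (char_poly A * g)
      = (\<Sum>l<n. poly_entry A i l (if l = j then char_poly A * g else 0))"
    using ij by (subst sum.remove[of _ j]) auto
  also have "\<dots> = (\<Sum>l<n. \<Sum>m<n. poly_entry A i l (B m * ?X $$ (l, m)))"
    using col by (auto simp: poly_entry_sum intro!: sum.cong)
  also have "\<dots> = (\<Sum>m<n. \<Sum>l<n. (if l = m then poly_entry A i m (pCons 0 (B m)) else 0)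
      - poly_entry A i l (B m) * A $$ (l, m))"
    by (subst sum.swap) (intro sum.cong refl, simp add: B_entry)
  also have "\<dots> = (\<Sum>m<n. poly_entry A i m (pCons 0 (B m)) - (\<Sum>l<n. poly_entry A i l (B m) * A $$ (l, m)))"
    by (simp add: sum_subtractf)
  also have "\<dots> = 0"
    using A ij by (simp add: poly_entry_shift)
  finally show ?thesis .
qed

text \<open>The first row of \<open>f(c I + N)\<close>, for the nilpotent shift \<open>N\<close>, lists the Taylor coefficients
  of \<open>f\<close> at \<open>c\<close>.\<close>

lemma poly_entry_jordan_block:
  assumes "j < n"
  shows "poly_entry (jordan_block n c) 0 j f = coeff (pcompose f [:c, 1:]) j"
  using assms
proof (induction f arbitrary: j)
  case 0
  then show ?case by simp
next
  case (pCons a g)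
  let ?J = "jordan_block n c"
  have J: "?J \<in> carrier_mat n n" by simp
  have "poly_entry ?J 0 j (pCons a g) = poly_entry ?J 0 j ([:a:] + pCons 0 g)" by simp
  also have "\<dots> = (if j = 0 then a else 0) + (\<Sum>l<n. poly_entry ?J 0 l g * ?J $$ (l, j))"
    unfolding poly_entry_add using pCons.prems by (simp add: poly_entry_shift[OF J] del: pCons_0_0)
  also have "(\<Sum>l<n. poly_entry ?J 0 l g * ?J $$ (l, j))
     = (\<Sum>l\<in>(if j = 0 then {j} else {j, j - 1}). poly_entry ?J 0 l g * ?J $$ (l, j))"
    using pCons.prems by (intro sum.mono_neutral_right) (auto split: if_splits)
  also have "(if j = 0 then a else 0) + \<dots> = coeff (pcompose (pCons a g) [:c, 1:]) j"
    using pCons.prems pCons.IH by (cases j) (auto simp: pcompose_pCons)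
  finally show ?case .
qed

section \<open>Integrality modulo a monic polynomial\<close>

text \<open>The ring \<open>V[x] + \<chi> K[x]\<close>, the preimage in \<open>K[x]\<close> of the image of \<open>V[x]\<close> in \<open>K[x] / (\<chi>)\<close>.
  If \<open>\<chi>\<close> is the characteristic polynomial of \<open>A\<close>, its members are sent into \<open>V[A]\<close> by evaluation
  at \<open>A\<close>, so that computations with matrices become computations with polynomials.\<close>

definition integral_mod :: "'k::field set \<Rightarrow> 'k poly \<Rightarrow> 'k poly set" where
  "integral_mod V \<chi> = {g + \<chi> * k | g k. g \<in> polys_over V}"

context unital_subring
begin

lemma det_closed:
  assumes "A \<in> carrier_mat n n" "\<And>i j. i < n \<Longrightarrow> j < n \<Longrightarrow> A $$ (i, j) \<in> S"
  shows "det A \<in> S"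
proof -
  have "p i < n" if "p permutes {0..<n}" "i < n" for p i
    using permutes_in_image[OF that(1), of i] that(2) by simp
  then show ?thesis
    using assms by (auto simp: det_def sign_def intro!: sum mult prod uminus)
qed

end

locale field_subring = unital_subring V for V :: "'k::field set"
begin

sublocale polys: unital_subring "polys_over V"
  unfolding polys_over_def by (rule unital_subring_polys)

lemma const_in_polys [intro]: "c \<in> V \<Longrightarrow> [:c:] \<in> polys_over V"
  by (auto simp: polys_over_def coeff_pCons split: nat.split)

lemma pCons_in_polys [intro]: "c \<in> V \<Longrightarrow> f \<in> polys_over V \<Longrightarrow> pCons c f \<in> polys_over V"
  by (auto simp: polys_over_def coeff_pCons split: nat.split)

lemma pCons_in_polys_iff: "pCons c f \<in> polys_over V \<longleftrightarrow> c \<in> V \<and> f \<in> polys_over V"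
  unfolding polys_over_def mem_Collect_eq by (metis coeff_pCons_0 coeff_pCons_Suc nat.exhaust)

lemma poly_closed: "f \<in> polys_over V \<Longrightarrow> c \<in> V \<Longrightarrow> poly f c \<in> V"
  by (auto simp: poly_altdef polys_over_def)

lemma synthetic_div_in_polys:
  assumes "f \<in> polys_over V" "c \<in> V"
  shows "synthetic_div f c \<in> polys_over V"
  using assms(1)
proof (induction f)
  case (pCons a f)
  then show ?case
    using assms(2) by (auto simp: pCons_in_polys_iff intro!: poly_closed)
qed simp

lemma char_poly_in_polys:
  assumes A: "A \<in> mats_over V n"
  shows "char_poly A \<in> polys_over V"
  unfolding char_poly_def using A
  by (intro polys.det_closed[of _ n])
    (auto simp: in_mats_over_iff char_poly_matrix_def intro!: pCons_in_polys uminus)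

lemma power_mat_closed:
  assumes "A \<in> mats_over V n"
  shows "A ^\<^sub>m k \<in> mats_over V n"
  using assms
proof (induction k)
  case (Suc k)
  then show ?case
    by (auto simp: in_mats_over_iff scalar_prod_def times_mat_def intro!: sum mult)
qed (auto simp: in_mats_over_iff)

lemma unital_subring_integral_mod: "unital_subring (integral_mod V \<chi>)"
proof
  show "1 \<in> integral_mod V \<chi>"
    unfolding integral_mod_def by (rule CollectI, rule exI[of _ 1], rule exI[of _ 0]) simp
next
  fix f f' assume "f \<in> integral_mod V \<chi>" "f' \<in> integral_mod V \<chi>"
  then obtain g k g' k' where *: "f = g + \<chi> * k" "f' = g' + \<chi> * k'"
    "g \<in> polys_over V" "g' \<in> polys_over V" by (auto simp: integral_mod_def)
  have "f - f' = (g - g') + \<chi> * (k - k')" by (simp add: * algebra_simps)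
  moreover have "g - g' \<in> polys_over V" "g * g' \<in> polys_over V" using * by auto
  ultimately show "f - f' \<in> integral_mod V \<chi>" by (auto simp only: integral_mod_def)
  have "f * f' = g * g' + \<chi> * (k * f' + g * k')" by (simp add: * algebra_simps)
  then show "f * f' \<in> integral_mod V \<chi>"
    using \<open>g * g' \<in> polys_over V\<close> by (auto simp only: integral_mod_def)
qed

lemma polys_in_integral_mod [intro]: "g \<in> polys_over V \<Longrightarrow> g \<in> integral_mod V \<chi>"
  unfolding integral_mod_def by (rule CollectI, rule exI[of _ g], rule exI[of _ 0]) simp

lemma multiple_in_integral_mod [intro]: "\<chi> * k \<in> integral_mod V \<chi>"
  unfolding integral_mod_def by (rule CollectI, rule exI[of _ 0], rule exI[of _ k]) simp

lemma in_Int_mat_if_integral_mod: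
  assumes "\<And>\<chi>. \<chi> \<in> polys_over V \<Longrightarrow> lead_coeff \<chi> = 1 \<Longrightarrow> degree \<chi> = n \<Longrightarrow> f \<in> integral_mod V \<chi>"
  shows "f \<in> Int_mat V n"
  unfolding Int_mat_def
proof (rule CollectI, rule ballI)
  fix A assume A: "A \<in> mats_over V n"
  then have A': "A \<in> carrier_mat n n" by (auto simp: in_mats_over_iff)
  have "f \<in> integral_mod V (char_poly A)"
    using degree_monic_char_poly[OF A'] char_poly_in_polys[OF A] by (intro assms) auto
  then obtain g k where f: "f = g + char_poly A * k" and g: "g \<in> polys_over V"
    by (auto simp: integral_mod_def)
  have "poly_entry A i j f \<in> V" if "i < n" "j < n" for i j
    unfolding f poly_entry_add Cayley_Hamilton_multiple[OF A' that]
    using g power_mat_closed[OF A] that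
    by (auto simp: poly_entry_def polys_over_def in_mats_over_iff intro!: sum mult)
  then show "poly_mat f A \<in> mats_over V n"
    using A' by (auto simp: in_mats_over_iff poly_mat_entry) (auto simp: poly_mat_def)
qed

text \<open>A necessary condition for integrality on matrices, read off a Jordan block with eigenvalue
  in \<open>V\<close>.\<close>

lemma Int_mat_taylor_coeff:
  assumes f: "f \<in> Int_mat V n" and c: "c \<in> V" and j: "j < n"
  shows "coeff (pcompose f [:c, 1:]) j \<in> V"
proof -
  have J: "jordan_block n c \<in> mats_over V n"
    using c by (auto simp: in_mats_over_iff jordan_block_def)
  then have "poly_mat f (jordan_block n c) \<in> mats_over V n"
    using f by (auto simp: Int_mat_def)
  then have "poly_mat f (jordan_block n c) $$ (0, j) \<in> V"
    using j by (auto simp only: in_mats_over_iff)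
  then have "poly_entry (jordan_block n c) 0 j f \<in> V"
    using j poly_mat_entry[of "jordan_block n c" n 0 j f] by simp
  then show ?thesis using poly_entry_jordan_block[OF j] by metis
qed

end

section \<open>Factorization over a finite field\<close>

lemma finite_polys_degree_le: "finite {f :: 'f::{finite,zero} poly. degree f \<le> n}"
proof (rule finite_subset)
  show "{f :: 'f poly. degree f \<le> n} \<subseteq> Poly ` {xs. set xs \<subseteq> UNIV \<and> length xs \<le> Suc n}"
  proof
    fix f :: "'f poly" assume "f \<in> {f. degree f \<le> n}"
    moreover have "f = Poly (coeffs f)" by simp
    moreover have "length (coeffs f) \<le> Suc (degree f)" by (simp add: coeffs_def)
    ultimately show "f \<in> Poly ` {xs. set xs \<subseteq> UNIV \<and> length xs \<le> Suc n}"
      by (metis (mono_tags, lifting) imageI le_trans Suc_le_mono mem_Collect_eq subset_UNIV)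
  qed
  show "finite (Poly ` {xs :: 'f list. set xs \<subseteq> UNIV \<and> length xs \<le> Suc n})"
    by (intro finite_imageI finite_lists_length_le) simp
qed

lemma finite_irreds: "finite (irreds n)"
  by (rule finite_subset[OF _ finite_polys_degree_le[of n]]) (auto simp: irreds_def)

lemma monic_irreducible_factorization:
  fixes X :: "'f::field poly"
  assumes "lead_coeff X = 1"
  obtains M where "prod_mset M = X"
    "\<And>p. p \<in># M \<Longrightarrow> lead_coeff p = 1 \<and> Factorial_Ring.irreducible p"
proof -
  have "\<exists>M. prod_mset M = X \<and> (\<forall>p\<in>#M. lead_coeff p = 1 \<and> Factorial_Ring.irreducible p)"
    using assms
  proof (induction "degree X" arbitrary: X rule: less_induct)
    case less
    show ?case
    proof (cases "degree X = 0")
      case True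
      then have "X = 1" using less.prems by (metis monic_degree_0)
      then show ?thesis by (intro exI[of _ "{#}"]) auto
    next
      case pos: False
      show ?thesis
      proof (cases "Factorial_Ring.irreducible X")
        case True
        then show ?thesis using less.prems by (intro exI[of _ "{#X#}"]) auto
      next
        case False
        have X: "X \<noteq> 0" using pos by auto
        moreover have "\<not> X dvd 1" using pos X by (simp add: is_unit_iff_degree)
        ultimately obtain a b where ab: "X = a * b" "\<not> a dvd 1" "\<not> b dvd 1"
          using False unfolding Factorial_Ring.irreducible_def by blast
        then have nz: "a \<noteq> 0" "b \<noteq> 0" using X by auto
        with ab have deg: "degree a > 0" "degree b > 0" by (auto simp: is_unit_iff_degree)
        define a' where "a' = smult (1 / lead_coeff a) a"
        define b' where "b' = smult (1 / lead_coeff b) b"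
        have lc: "lead_coeff a * lead_coeff b = 1"
          using less.prems ab by (simp add: lead_coeff_mult)
        have "a' * b' = smult (1 / (lead_coeff a * lead_coeff b)) (a * b)"
          by (simp add: a'_def b'_def mult.commute)
        then have prod: "a' * b' = X" using lc ab by simp
        have monic: "lead_coeff a' = 1" "lead_coeff b' = 1"
          using nz by (auto simp: a'_def b'_def)
        have "degree X = degree a + degree b" using ab nz by (simp add: degree_mult_eq)
        then have "degree a' < degree X" "degree b' < degree X"
          using deg nz by (auto simp: a'_def b'_def)
        with less.hyps monic obtain M N where
          "prod_mset M = a'" "\<forall>p\<in>#M. lead_coeff p = 1 \<and> Factorial_Ring.irreducible p"
          "prod_mset N = b'" "\<forall>p\<in>#N. lead_coeff p = 1 \<and> Factorial_Ring.irreducible p"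
          by metis
        then show ?thesis using prod by (intro exI[of _ "M + N"]) auto
      qed
    qed
  qed
  then show ?thesis using that by blast
qed

lemma monic_linear_form: "degree p = 1 \<Longrightarrow> lead_coeff p = 1 \<Longrightarrow> \<exists>b. p = [:- b, 1 :: 'f::field:]"
  by (intro exI[of _ "- coeff p 0"] poly_eqI) (auto simp: coeff_pCons coeff_eq_0 split: nat.split)

text \<open>In a factorization of \<open>X\<close> into monic irreducibles, a factor of degree \<open>d\<close> occurs at most
  \<open>n div d\<close> times, and those of degree 1 occur at most \<open>m\<close> times by assumption.\<close>

lemma monic_dvd_prod_irreds:
  fixes X :: "'f::{finite,field} poly"
  assumes monic: "lead_coeff X = 1" and deg: "degree X = n"
    and mult: "\<And>b k. [:- b, 1:] ^ k dvd X \<Longrightarrow> k \<le> m"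
  shows "X dvd (\<Prod>f\<in>irreds n. f ^ (n div degree f)) * (\<Prod>b\<in>UNIV. [:- b, 1:] ^ m)"
proof -
  obtain M where X: "prod_mset M = X"
    and M: "\<And>p. p \<in># M \<Longrightarrow> lead_coeff p = 1 \<and> Factorial_Ring.irreducible p"
    using monic_irreducible_factorization[OF monic] by blast
  have "X \<noteq> 0" using monic by auto
  have dvd: "p ^ count M p dvd X" if "p \<in># M" for p
    unfolding X[symmetric] prod_mset_multiplicity using that by (intro dvd_prodI) auto
  have bound: "count M p * degree p \<le> n" if "p \<in># M" for p
    using dvd_imp_degree_le[OF dvd[OF that] \<open>X \<noteq> 0\<close>] M[OF that] deg
    by (subst (asm) degree_power_eq) (auto simp: mult.commute)
  \<comment> \<open>\<open>L\<close> consists of the monic irreducibles of degree 1, which \<open>irreds n\<close> leaves out.\<close>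
  define L where "L = range (\<lambda>b :: 'f. [:- b, 1:])"
  have disj: "irreds n \<inter> L = {}" by (auto simp: irreds_def L_def)
  have cover: "set_mset M \<subseteq> irreds n \<union> L"
  proof
    fix p assume p: "p \<in># M"
    have "degree p > 0"
      using M[OF p] by (metis Factorial_Ring.irreducible_def bot_nat_0.not_eq_extremum is_unit_iff_degree)
    moreover have "degree p \<le> n"
      using bound[OF p] p
      by (metis count_greater_zero_iff dual_order.trans le_square mult_le_mono1 nat_mult_1
          Suc_leI One_nat_def)
    moreover have "p \<in> L" if "degree p = 1"
      using monic_linear_form[OF that] M[OF p] by (auto simp: L_def)
    ultimately show "p \<in> irreds n \<union> L" using M[OF p] by (fastforce simp: irreds_def)
  qed
  have "X = (\<Prod>p\<in>set_mset M. p ^ count M p)" unfolding X[symmetric] by (rule prod_mset_multiplicity)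
  also have "\<dots> = (\<Prod>p\<in>irreds n \<union> L. p ^ count M p)"
    using cover by (intro prod.mono_neutral_left) (auto simp: finite_irreds L_def not_in_iff)
  also have "\<dots> = (\<Prod>p\<in>irreds n. p ^ count M p) * (\<Prod>p\<in>L. p ^ count M p)"
    by (intro prod.union_disjoint finite_irreds disj) (simp add: L_def)
  also have "(\<Prod>p\<in>L. p ^ count M p) = (\<Prod>b\<in>UNIV. [:- b, 1:] ^ count M [:- b, 1:])"
    unfolding L_def by (subst prod.reindex) (auto intro!: injI)
  also have "(\<Prod>p\<in>irreds n. p ^ count M p) * \<dots>
      dvd (\<Prod>p\<in>irreds n. p ^ (n div degree p)) * (\<Prod>b\<in>UNIV. [:- b, 1:] ^ m)"
  proof (intro mult_dvd_mono prod_dvd_prod le_imp_power_dvd)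
    fix p :: "'f poly" assume p: "p \<in> irreds n"
    then have "count M p * degree p \<le> n" using bound[of p] by (cases "p \<in># M") (auto simp: not_in_iff)
    then show "count M p \<le> n div degree p"
      using p by (auto simp: irreds_def less_eq_div_iff_mult_less_eq)
  next
    fix b show "count M [:- b, 1:] \<le> m"
      using dvd[of "[:- b, 1:]"] mult[of b] by (cases "[:- b, 1:] \<in># M") (auto simp: not_in_iff)
  qed
  finally show ?thesis .
qed

section \<open>Reduction modulo the uniformizer\<close>

text \<open>Division by \<open>\<pi>\<close> takes place in the field \<open>K\<close>, so \<open>x / \<pi> \<in> V\<close> expresses that \<open>x\<close> lies in
  \<open>\<pi> V\<close>.\<close>

locale residue_reps = field_subring V for V :: "'k::field set" +
  fixes \<pi> :: 'k and res :: "'k \<Rightarrow> 'f::{finite,field}" and rep :: "'f \<Rightarrow> 'k"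
  assumes pi_in: "\<pi> \<in> V" and pi_nz: "\<pi> \<noteq> 0"
    and res_add: "x \<in> V \<Longrightarrow> y \<in> V \<Longrightarrow> res (x + y) = res x + res y"
    and res_mult: "x \<in> V \<Longrightarrow> y \<in> V \<Longrightarrow> res (x * y) = res x * res y"
    and res_1 [simp]: "res 1 = 1"
    and res_eq_0_iff: "x \<in> V \<Longrightarrow> res x = 0 \<longleftrightarrow> x / \<pi> \<in> V"
    and rep_in [simp, intro]: "rep c \<in> V"
    and res_rep [simp]: "res (rep c) = c"
begin

lemma res_0 [simp]: "res 0 = 0"
  using res_add[OF zero zero] by (metis add_0 add_cancel_left_right)

lemma res_pi [simp]: "res \<pi> = 0"
  using pi_in pi_nz res_eq_0_iff by simp

lemma res_diff: "x \<in> V \<Longrightarrow> y \<in> V \<Longrightarrow> res (x - y) = res x - res y"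
  using res_add[of "x - y" y] by (simp add: diff)

lemma res_uminus: "x \<in> V \<Longrightarrow> res (- x) = - res x"
  using res_diff[of 0 x] by simp

lemma res_sum: "(\<And>i. i \<in> I \<Longrightarrow> f i \<in> V) \<Longrightarrow> res (sum f I) = (\<Sum>i\<in>I. res (f i))"
  by (induction I rule: infinite_finite_induct) (auto simp: res_add sum)

lemma res_prod: "(\<And>i. i \<in> I \<Longrightarrow> f i \<in> V) \<Longrightarrow> res (prod f I) = (\<Prod>i\<in>I. res (f i))"
  by (induction I rule: infinite_finite_induct) (auto simp: res_mult prod)

abbreviation reduce :: "'k poly \<Rightarrow> 'f poly" where
  "reduce \<equiv> map_poly res"

lemma coeff_reduce [simp]: "coeff (reduce f) i = res (coeff f i)"
  by (simp add: coeff_map_poly)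

lemma reduce_pCons [simp]: "reduce (pCons c f) = pCons (res c) (reduce f)"
  by (rule poly_eqI) (simp add: coeff_pCons split: nat.split)

lemma reduce_1 [simp]: "reduce 1 = 1"
  by (simp add: one_pCons)

lemma reduce_add: "f \<in> polys_over V \<Longrightarrow> g \<in> polys_over V \<Longrightarrow> reduce (f + g) = reduce f + reduce g"
  by (rule poly_eqI) (auto simp: polys_over_def res_add)

lemma reduce_diff: "f \<in> polys_over V \<Longrightarrow> g \<in> polys_over V \<Longrightarrow> reduce (f - g) = reduce f - reduce g"
  by (rule poly_eqI) (auto simp: polys_over_def res_diff)

lemma reduce_mult: "f \<in> polys_over V \<Longrightarrow> g \<in> polys_over V \<Longrightarrow> reduce (f * g) = reduce f * reduce g"
  by (rule poly_eqI) (auto simp: polys_over_def coeff_mult res_sum res_mult mult intro!: sum.cong)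

lemma reduce_power: "f \<in> polys_over V \<Longrightarrow> reduce (f ^ k) = reduce f ^ k"
  by (induction k) (auto simp: reduce_mult polys.power)

lemma reduce_prod:
  "(\<And>i. i \<in> I \<Longrightarrow> f i \<in> polys_over V) \<Longrightarrow> reduce (prod f I) = (\<Prod>i\<in>I. reduce (f i))"
  by (induction I rule: infinite_finite_induct) (auto simp: reduce_mult polys.prod)

lemma res_poly: "f \<in> polys_over V \<Longrightarrow> c \<in> V \<Longrightarrow> res (poly f c) = poly (reduce f) (res c)"
proof (induction f)
  case (pCons a f)
  then show ?case
    by (simp add: pCons_in_polys_iff res_add res_mult poly_closed mult)
qed simp

lemma lift_exists: "\<exists>M\<in>polys_over V. reduce M = m"
proof (induction m)
  case 0
  then show ?case by (intro bexI[of _ 0]) auto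
next
  case (pCons a m)
  then obtain M where "M \<in> polys_over V" "reduce M = m" by blast
  then show ?case by (intro bexI[of _ "pCons (rep a) M"]) auto
qed

lemma div_pi_in_polys:
  assumes "f \<in> polys_over V" "reduce f = 0"
  shows "[:1 / \<pi>:] * f \<in> polys_over V"
proof -
  have "coeff f i / \<pi> \<in> V" for i
    using assms res_eq_0_iff[of "coeff f i"] coeff_reduce[of f i] by (auto simp: polys_over_def)
  then show ?thesis by (auto simp: polys_over_def)
qed

text \<open>If \<open>g\<close> is a multiple of \<open>\<chi>\<close> modulo \<open>\<pi>\<close>, then subtracting a lift of that multiple leaves a
  polynomial that \<open>\<pi>\<close> divides in \<open>V[x]\<close>.\<close>

lemma div_pi_in_integral_mod:
  assumes \<chi>: "\<chi> \<in> polys_over V" and g: "g \<in> polys_over V" and dvd: "reduce \<chi> dvd reduce g"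
  shows "[:1 / \<pi>:] * g \<in> integral_mod V \<chi>"
proof -
  obtain m where m: "reduce g = reduce \<chi> * m" using dvd by blast
  obtain M where M: "M \<in> polys_over V" "reduce M = m" using lift_exists by blast
  have "[:1 / \<pi>:] * (g - \<chi> * M) \<in> polys_over V"
    using \<chi> g M m by (intro div_pi_in_polys) (auto simp: reduce_diff reduce_mult polys.mult)
  moreover have "[:1 / \<pi>:] * g = [:1 / \<pi>:] * (g - \<chi> * M) + \<chi> * ([:1 / \<pi>:] * M)"
    by (simp only: right_diff_distrib mult.left_commute diff_add_cancel)
  ultimately show ?thesis unfolding integral_mod_def by blast
qed

section \<open>Characteristic polynomials that reduce to a power of a linear polynomial\<close>

lemma pi_inverse: "[:1 / \<pi>:] * [:\<pi>:] = 1"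
  using pi_nz by (simp add: one_pCons)

text \<open>Here \<open>\<beta>\<^sup>n = \<chi> + \<pi> C\<close> with \<open>C = c0 + \<beta> D\<close> over \<open>V\<close>, so each of the \<open>q - 1\<close> factors
  \<open>\<beta>\<^sup>n + \<pi> a\<close> of \<open>h(\<beta>)\<close> is \<open>\<pi>\<close> times an element \<open>K a\<close> of \<open>S\<close>. One division by \<open>\<pi>\<close> remains and
  falls on \<open>\<beta>\<^bsup>n - 1\<^esup>\<close>: \<open>F\<close> is an element of \<open>S\<close> times \<open>z = \<beta>\<^bsup>n - 1\<^esup> / \<pi>\<close>, where \<open>\<beta> z\<close> and \<open>\<pi> z\<close>
  are in \<open>S\<close>.

  If \<open>c0\<close> is a unit (the Eisenstein case), the factor for the class of \<open>- c0\<close> has \<open>K a\<close> in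
  \<open>\<beta> S + \<pi> S + \<chi> K[x]\<close>, which absorbs the denominator of \<open>z\<close>, so \<open>F\<close> itself is in \<open>S\<close>. If \<open>\<pi>\<close>
  divides \<open>c0\<close>, then \<open>z\<^sup>2 = \<beta>\<^bsup>n - 2\<^esup> \<beta>\<^sup>n / \<pi>\<^sup>2\<close> differs from \<open>D z\<close> by an element of \<open>S\<close>; this is
  a monic quadratic equation for \<open>z\<close> over \<open>S\<close>, and it passes to \<open>F\<close>.\<close>

lemma linear_power_case:
  fixes F W \<chi> :: "'k poly" and b :: 'f and n :: nat
  defines "S \<equiv> integral_mod V \<chi>"
  defines "\<beta> \<equiv> [:- rep b, 1:]"
  assumes n: "n \<ge> 2" and \<chi>: "\<chi> \<in> polys_over V" and red: "reduce \<chi> = [:- b, 1:] ^ n"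
    and W: "W \<in> polys_over V"
    and F: "F = [:1 / \<pi>:] ^ CARD('f) * (\<beta> ^ (n - 1) * (\<Prod>a\<in>UNIV - {0}. \<beta> ^ n + [:\<pi> * rep a:])) * W"
  shows "\<beta> * F \<in> S" "[:\<pi>:] * F \<in> S" "\<exists>u\<in>S. F\<^sup>2 + u * F \<in> S"
proof -
  interpret S: unital_subring S
    unfolding S_def by (rule unital_subring_integral_mod)
  have V_S: "g \<in> S" if "g \<in> polys_over V" for g using that unfolding S_def by blast
  have \<chi>_S: "\<chi> * k \<in> S" for k unfolding S_def by blast
  define i p where "i = [:1 / \<pi>:]" and "p = [:\<pi>:]"
  have ip: "i * p = 1" unfolding i_def p_def by (rule pi_inverse)
  have \<beta>_V: "\<beta> \<in> polys_over V" by (auto simp: \<beta>_def intro!: pCons_in_polys uminus)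
  have red_\<beta>: "reduce \<beta> = [:- b, 1:]" by (simp add: \<beta>_def res_uminus)
  define C where "C = i * (\<beta> ^ n - \<chi>)"
  have C_V: "C \<in> polys_over V"
    unfolding C_def i_def using \<chi> \<beta>_V red red_\<beta>
    by (intro div_pi_in_polys) (auto simp: reduce_diff reduce_power polys.power)
  define c0 D where "c0 = poly C (rep b)" and "D = synthetic_div C (rep b)"
  have C_eq: "C = \<beta> * D + [:c0:]"
    using synthetic_div_correct'[of "rep b" C] by (simp add: \<beta>_def c0_def D_def)
  have c0: "c0 \<in> V" unfolding c0_def using C_V by (simp add: poly_closed)
  have D_V: "D \<in> polys_over V" unfolding D_def using C_V by (rule synthetic_div_in_polys) simp
  have \<beta>n: "i * \<beta> ^ n = \<chi> * i + C" by (simp add: C_def algebra_simps)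
  define K where "K a = i * (\<beta> ^ n + [:\<pi> * rep a:])" for a
  have K_eq: "K a = \<chi> * i + C + [:rep a:]" for a
  proof -
    have "[:\<pi> * rep a:] = p * [:rep a:]" by (simp add: p_def)
    then have "K a = i * \<beta> ^ n + (i * p) * [:rep a:]" by (simp add: K_def algebra_simps)
    then show ?thesis by (simp add: \<beta>n ip)
  qed
  have K_S: "K a \<in> S" for a unfolding K_eq using C_V by (intro S.add \<chi>_S V_S) auto
  define z where "z = i * \<beta> ^ (n - 1)"
  have "CARD('f) = Suc (card (UNIV - {0 :: 'f}))" by (simp add: card_Diff_singleton)
  then have F_eq: "F = z * ((\<Prod>a\<in>UNIV - {0}. K a) * W)"
    unfolding F K_def z_def i_def[symmetric] prod.distrib prod_constant
    by (simp only: power_Suc mult_ac)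
  have \<beta>z: "\<beta> * z \<in> S"
  proof -
    have "\<beta> * z = i * \<beta> ^ n" using n by (cases n) (auto simp: z_def mult_ac)
    then show ?thesis using C_V by (simp only: \<beta>n) (intro S.add \<chi>_S V_S)
  qed
  have pz: "p * z \<in> S"
  proof -
    have "p * z = (i * p) * \<beta> ^ (n - 1)" by (simp only: z_def mult_ac)
    then show ?thesis using \<beta>_V by (simp add: ip V_S polys.power)
  qed
  show "\<beta> * F \<in> S" "[:\<pi>:] * F \<in> S"
  proof -
    have *: "(\<Prod>a\<in>UNIV - {0}. K a) * W \<in> S" using W K_S by (intro S.mult S.prod V_S[of W] K_S)
    show "\<beta> * F \<in> S" unfolding F_eq mult.assoc[symmetric, of \<beta>] using * \<beta>z by (rule S.mult[rotated])
    show "[:\<pi>:] * F \<in> S" unfolding F_eq mult.assoc[symmetric, of "[:\<pi>:]"]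
      using * pz unfolding p_def by (rule S.mult[rotated])
  qed
  show "\<exists>u\<in>S. F\<^sup>2 + u * F \<in> S"
  proof (cases "res c0 = 0")
    case False
    define a where "a = - res c0"
    define w where "w = (c0 + rep a) / \<pi>"
    have "res (c0 + rep a) = 0" using c0 by (simp add: res_add a_def)
    then have w: "w \<in> V" using c0 by (simp add: res_eq_0_iff w_def add)
    have "c0 + rep a = \<pi> * w" using pi_nz by (simp add: w_def)
    then have "K a = \<chi> * i + \<beta> * D + p * [:w:]"
      unfolding K_eq C_eq by (simp add: p_def algebra_simps)
    then have "z * K a = \<chi> * (i * z) + (\<beta> * z) * D + (p * z) * [:w:]"
      by (simp add: algebra_simps)
    also have "\<dots> \<in> S" using D_V w by (intro S.add S.mult \<chi>_S \<beta>z pz V_S) auto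
    finally have zK: "z * K a \<in> S" .
    have "a \<in> UNIV - {0}" using False by (simp add: a_def)
    then have "(\<Prod>a\<in>UNIV - {0}. K a) = K a * (\<Prod>a\<in>UNIV - {0} - {a}. K a)"
      by (intro prod.remove) auto
    then have "F = (z * K a) * ((\<Prod>a\<in>UNIV - {0} - {a}. K a) * W)"
      unfolding F_eq by (simp only: mult.assoc)
    also have "\<dots> \<in> S" using W by (intro S.mult S.prod V_S[of W] K_S zK)
    finally show ?thesis by (intro bexI[of _ 0]) (auto simp: S.power)
  next
    case True
    define w where "w = c0 / \<pi>"
    have w: "w \<in> V" using True c0 by (simp add: res_eq_0_iff w_def)
    have c0_eq: "[:c0:] = p * [:w:]" using pi_nz by (simp add: w_def p_def)
    obtain m where m: "n = Suc (Suc m)" using n by (metis add_2_eq_Suc le_Suc_ex)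
    have "z\<^sup>2 = i * \<beta> ^ m * (i * \<beta> ^ n)"
      by (simp add: z_def m power2_eq_square algebra_simps)
    also have "\<dots> = \<chi> * (i * i * \<beta> ^ m) + z * D + (i * p) * (\<beta> ^ m * [:w:])"
      unfolding \<beta>n C_eq c0_eq by (simp add: z_def m algebra_simps)
    finally have "z\<^sup>2 + (- D) * z = \<chi> * (i * i * \<beta> ^ m) + \<beta> ^ m * [:w:]"
      by (simp add: ip algebra_simps)
    also have "\<dots> \<in> S" using w \<beta>_V by (intro S.add \<chi>_S V_S polys.mult polys.power const_in_polys)
    finally have z2: "z\<^sup>2 + (- D) * z \<in> S" .
    define s where "s = (\<Prod>a\<in>UNIV - {0}. K a) * W"
    have s: "s \<in> S" unfolding s_def using W K_S by (intro S.mult S.prod V_S[of W] K_S)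
    have "F\<^sup>2 + (- D * s) * F = s\<^sup>2 * (z\<^sup>2 + (- D) * z)"
      unfolding F_eq s_def[symmetric] by (simp add: power2_eq_square algebra_simps)
    also have "\<dots> \<in> S" using s z2 by (intro S.mult S.power)
    finally show ?thesis using s by (rule bexI[OF _ S.mult[OF S.uminus[OF V_S[OF D_V]]]])
  qed
qed

end

section \<open>The constructed polynomial\<close>

lemma to_fract_prod: "to_fract (prod f I) = (\<Prod>x\<in>I. to_fract (f x))"
  by (induction I rule: infinite_finite_induct) simp_all

lemma pcompose_monom_1: "pcompose (monom 1 m) p = p ^ m"
  by (induction m) (simp_all add: monom_Suc pcompose_pCons pcompose_1 monom_0 flip: one_pCons)

lemma pcompose_power: "pcompose (f ^ k) p = pcompose f p ^ k"
  by (induction k) (simp_all add: pcompose_mult pcompose_1)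

lemma pcompose_h_poly:
  "pcompose (h_poly n \<pi> rep) p = p ^ (n - 1) * (\<Prod>a\<in>UNIV - {0}. p ^ n + [:\<pi> * rep a:])"
  by (simp add: h_poly_def pcompose_mult pcompose_prod pcompose_add pcompose_monom_1)

locale lifted_construction = residue_reps V \<pi> res rep
  for V :: "'k::field set" and \<pi> :: 'k and res :: "'k \<Rightarrow> 'f::{finite,field}"
    and rep :: "'f \<Rightarrow> 'k" +
  fixes n :: nat and lft :: "'f poly \<Rightarrow> 'k poly"
  assumes n: "n \<ge> 2" and lifts: "monic_lifts V res n lft"
begin

abbreviation \<theta> :: "'k poly" where "\<theta> \<equiv> theta_poly n lft"
abbreviation F :: "'k poly" where "F \<equiv> F_poly n \<pi> rep lft"
abbreviation lin :: "'f \<Rightarrow> 'k poly" where "lin b \<equiv> [:- rep b, 1:]"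
abbreviation eisen :: "'f \<Rightarrow> 'f \<Rightarrow> 'k poly" where "eisen b a \<equiv> lin b ^ n + [:\<pi> * rep a:]"

lemma lin_in_polys: "lin b \<in> polys_over V"
  by (auto simp: pCons_in_polys_iff)

lemma eis_in_polys: "eisen b a \<in> polys_over V"
  using lin_in_polys pi_in by (intro polys.add polys.power const_in_polys mult) auto

lemma reduce_lin: "reduce (lin b) = [:- b, 1:]"
  by (simp add: res_uminus)

lemma reduce_eis: "reduce (eisen b a) = [:- b, 1:] ^ n"
proof -
  have "[:\<pi> * rep a:] \<in> polys_over V" using pi_in by (intro const_in_polys mult) auto
  then have "reduce (eisen b a) = reduce (lin b) ^ n + reduce [:\<pi> * rep a:]"
    using lin_in_polys by (simp only: reduce_add reduce_power polys.power)
  then show ?thesis using pi_in by (simp add: res_mult res_uminus)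
qed

lemma theta_in_polys: "\<theta> \<in> polys_over V"
  using lifts unfolding theta_poly_def monic_lifts_def by (intro polys.prod polys.power) auto

lemma reduce_theta: "reduce \<theta> = (\<Prod>f\<in>irreds n. f ^ (n div degree f))"
  using lifts unfolding theta_poly_def monic_lifts_def
  by (subst reduce_prod) (auto simp: reduce_power polys.power intro!: prod.cong)

lemma F_factored:
  "F = [:1 / \<pi>:] ^ CARD('f) *
    ((\<Prod>b\<in>UNIV. lin b ^ (n - 1) * (\<Prod>a\<in>UNIV - {0}. eisen b a)) * \<theta> ^ CARD('f))"
  unfolding F_poly_def H_poly_def pcompose_h_poly
  by (simp add: poly_const_pow power_one_over)

lemma card_residue_field: "CARD('f) = Suc (card (UNIV - {0 :: 'f}))"
  by (simp add: card_Diff_singleton)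

text \<open>Regroup \<open>H \<theta>\<^sup>q\<close> as the product of \<open>L = \<theta> \<Prod>b. (x - b)\<^bsup>n - 1\<^esup>\<close> and of the \<open>q - 1\<close>
  polynomials \<open>M a = \<theta> \<Prod>b. ((x - b)\<^sup>n + \<pi> a)\<close>. Modulo \<open>\<pi>\<close> the polynomial \<open>\<chi>\<close> divides each of
  these \<open>q\<close> factors, because none of its linear factors has multiplicity \<open>n\<close>; so each factor
  absorbs one \<open>\<pi>\<close> of the denominator.\<close>

lemma F_integral_mod_not_linear_power:
  assumes \<chi>: "\<chi> \<in> polys_over V" "lead_coeff \<chi> = 1" "degree \<chi> = n"
    and not_power: "\<And>b. reduce \<chi> \<noteq> [:- b, 1:] ^ n"
  shows "F \<in> integral_mod V \<chi>"
proof -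
  interpret S: unital_subring "integral_mod V \<chi>" by (rule unital_subring_integral_mod)
  have lead: "coeff (reduce \<chi>) n = 1" using \<chi> by simp
  have deg: "degree (reduce \<chi>) = n"
    using lead \<chi>(3) by (intro antisym degree_le le_degree) (auto simp: coeff_eq_0)
  have "k \<le> n - 1" if dvd: "[:- b, 1:] ^ k dvd reduce \<chi>" for b k
  proof (rule ccontr)
    assume "\<not> k \<le> n - 1"
    then have "[:- b, 1:] ^ n dvd reduce \<chi>" by (intro dvd_trans[OF le_imp_power_dvd dvd]) auto
    then obtain c where c: "reduce \<chi> = [:- b, 1:] ^ n * c" by blast
    have "c \<noteq> 0" using c lead by auto
    then have "degree (reduce \<chi>) = n + degree c"
      unfolding c by (subst degree_mult_eq) (auto simp: degree_linear_power)
    then have "degree c = 0" using deg by simp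
    moreover have "lead_coeff c = 1"
      using lead deg c
      by (metis lead_coeff_mult lead_coeff_power lead_coeff_pCons(1) lead_coeff_1 mult_1
          power_one one_pCons one_neq_zero pCons_eq_0_iff)
    ultimately have "c = 1" by (rule monic_degree_0[THEN iffD1, rotated])
    then show False using c not_power by simp
  qed
  then have dvd: "reduce \<chi> dvd reduce \<theta> * (\<Prod>b\<in>UNIV. [:- b, 1:] ^ (n - 1))"
    unfolding reduce_theta using lead deg by (intro monic_dvd_prod_irreds) auto
  define L where "L = \<theta> * (\<Prod>b\<in>UNIV. lin b ^ (n - 1))"
  define M where "M a = \<theta> * (\<Prod>b\<in>UNIV. eisen b a)" for a
  have polys: "(\<Prod>b\<in>UNIV. lin b ^ (n - 1)) \<in> polys_over V"
    "(\<Prod>b\<in>UNIV. eisen b a) \<in> polys_over V" for a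
    using lin_in_polys eis_in_polys by (intro polys.prod polys.power; blast)+
  have "reduce L = reduce \<theta> * (\<Prod>b\<in>UNIV. [:- b, 1:] ^ (n - 1))"
    unfolding L_def using polys theta_in_polys lin_in_polys
    by (simp only: reduce_mult reduce_prod reduce_power reduce_lin polys.power)
  then have L: "[:1 / \<pi>:] * L \<in> integral_mod V \<chi>"
    using dvd polys theta_in_polys \<chi>(1)
    by (intro div_pi_in_integral_mod) (auto simp: L_def simp del: mult_pCons_left intro!: polys.mult)
  have "reduce (M a) = reduce \<theta> * (\<Prod>b\<in>UNIV. [:- b, 1:] ^ n)" for a
    unfolding M_def using polys theta_in_polys eis_in_polys
    by (simp only: reduce_mult reduce_prod reduce_eis)
  moreover have "reduce \<theta> * (\<Prod>b\<in>UNIV. [:- b, 1:] ^ (n - 1))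
      dvd reduce \<theta> * (\<Prod>b\<in>UNIV. [:- b, 1:] ^ n)"
    by (intro mult_dvd_mono prod_dvd_prod le_imp_power_dvd) auto
  ultimately have M: "[:1 / \<pi>:] * M a \<in> integral_mod V \<chi>" for a
    using dvd polys theta_in_polys \<chi>(1)
    by (intro div_pi_in_integral_mod)
      (auto simp: M_def simp del: mult_pCons_left intro!: polys.mult intro: dvd_trans)
  have "F = [:1 / \<pi>:] * L * (\<Prod>a\<in>UNIV - {0}. [:1 / \<pi>:] * M a)"
  proof -
    \<comment> \<open>The factor \<open>\<theta>\<^sup>q\<close> gives one \<open>\<theta>\<close> to \<open>L\<close> and one to each \<open>M a\<close>.\<close>
    have "(\<Prod>b\<in>UNIV. \<Prod>a\<in>UNIV - {0}. eisen b a) = (\<Prod>a\<in>UNIV - {0}. \<Prod>b\<in>UNIV. eisen b a)"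
      by (rule prod.swap)
    then show ?thesis
      unfolding F_factored L_def M_def card_residue_field prod.distrib prod_constant power_Suc
      by (simp only: mult_ac)
  qed
  also have "\<dots> \<in> integral_mod V \<chi>" by (rule S.mult[OF L S.prod[OF M]])
  finally show ?thesis .
qed

lemma F_integral_mod_linear_power:
  assumes \<chi>: "\<chi> \<in> polys_over V" and red: "reduce \<chi> = [:- b, 1:] ^ n"
  shows "lin b * F \<in> integral_mod V \<chi>" "[:\<pi>:] * F \<in> integral_mod V \<chi>"
    "\<exists>u\<in>integral_mod V \<chi>. F\<^sup>2 + u * F \<in> integral_mod V \<chi>"
proof -
  let ?h = "\<lambda>b. lin b ^ (n - 1) * (\<Prod>a\<in>UNIV - {0}. eisen b a)"
  define W where "W = (\<Prod>b\<in>UNIV - {b}. ?h b) * \<theta> ^ CARD('f)"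
  have W: "W \<in> polys_over V"
    unfolding W_def using lin_in_polys eis_in_polys theta_in_polys
    by (intro polys.mult polys.prod polys.power)
  have "(\<Prod>b\<in>UNIV. ?h b) = ?h b * (\<Prod>b\<in>UNIV - {b}. ?h b)"
    by (rule prod.remove) auto
  then have "F = [:1 / \<pi>:] ^ CARD('f) * ?h b * W"
    unfolding F_factored W_def by (simp only: mult.assoc)
  from linear_power_case[OF n \<chi> red W this]
  show "lin b * F \<in> integral_mod V \<chi>" "[:\<pi>:] * F \<in> integral_mod V \<chi>"
    "\<exists>u\<in>integral_mod V \<chi>. F\<^sup>2 + u * F \<in> integral_mod V \<chi>" .
qed

text \<open>By \<open>in_Int_mat_if_integral_mod\<close> one may work modulo \<open>\<chi>\<close>. When \<open>\<chi>\<close> reduces to \<open>(x - b)\<^sup>n\<close>,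
  every element of \<open>V[x] + \<chi> K[x]\<close> is a representative of a residue class up to multiples of
  \<open>\<pi>\<close>, of \<open>x - b\<close> and of \<open>\<chi>\<close>, and these three multiply \<open>F\<close> into the ring; so \<open>prod_quadratics\<close>
  applies.\<close>

lemma const_diff_prod_quadratics_in_Int_mat:
  assumes v: "v \<in> V"
  shows "[:v:] - (\<Prod>(c, d)\<in>UNIV. F\<^sup>2 + [:rep c:] * F + [:rep d:]) \<in> Int_mat V n"
proof (rule in_Int_mat_if_integral_mod)
  fix \<chi> assume \<chi>: "\<chi> \<in> polys_over V" "lead_coeff \<chi> = 1" "degree \<chi> = n"
  interpret S: unital_subring "integral_mod V \<chi>" by (rule unital_subring_integral_mod)
  have rep: "[:rep c:] \<in> integral_mod V \<chi>" for c by (intro polys_in_integral_mod const_in_polys) auto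
  have "(\<Prod>(c, d)\<in>UNIV. F\<^sup>2 + [:rep c:] * F + [:rep d:]) \<in> integral_mod V \<chi>"
  proof (cases "\<exists>b. reduce \<chi> = [:- b, 1:] ^ n")
    case False
    then have "F \<in> integral_mod V \<chi>" using \<chi> by (intro F_integral_mod_not_linear_power) auto
    then show ?thesis
      using rep by (intro S.prod) (simp only: split_def, intro S.add S.mult S.power)
  next
    case True
    then obtain b where b: "reduce \<chi> = [:- b, 1:] ^ n" by blast
    note lin_F = F_integral_mod_linear_power[OF \<chi>(1) b]
    have "\<exists>c. (s - [:rep c:]) * F \<in> integral_mod V \<chi>" if "s \<in> integral_mod V \<chi>" for s
    proof -
      from that obtain g k where s: "s = g + \<chi> * k" and g: "g \<in> polys_over V"
        by (auto simp: integral_mod_def)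
      define v where "v = poly g (rep b)"
      have v: "v \<in> V" unfolding v_def using g by (simp add: poly_closed)
      define w where "w = (v - rep (res v)) / \<pi>"
      have "res (v - rep (res v)) = 0" using v by (simp add: res_diff)
      then have w: "w \<in> V" using v by (simp add: w_def res_eq_0_iff diff)
      have "[:v:] - [:rep (res v):] = [:w:] * [:\<pi>:]" using pi_nz by (simp add: w_def)
      moreover have "g = lin b * synthetic_div g (rep b) + [:v:]"
        using synthetic_div_correct'[of "rep b" g] by (simp add: v_def)
      ultimately have "s - [:rep (res v):] = synthetic_div g (rep b) * lin b + [:w:] * [:\<pi>:] + \<chi> * k"
        unfolding s by (metis (no_types, lifting) add.assoc add.commute add_diff_eq mult.commute)
      then have "(s - [:rep (res v):]) * F
          = synthetic_div g (rep b) * (lin b * F) + [:w:] * ([:\<pi>:] * F) + \<chi> * (k * F)"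
        by (simp only: distrib_right mult.assoc)
      also have "\<dots> \<in> integral_mod V \<chi>"
      proof (intro S.add multiple_in_integral_mod)
        show "synthetic_div g (rep b) * (lin b * F) \<in> integral_mod V \<chi>"
          using synthetic_div_in_polys[OF g rep_in] lin_F(1) by (rule S.mult[OF polys_in_integral_mod])
        show "[:w:] * ([:\<pi>:] * F) \<in> integral_mod V \<chi>"
          using const_in_polys[OF w] lin_F(2) by (rule S.mult[OF polys_in_integral_mod])
      qed
      finally show ?thesis by blast
    qed
    with rep lin_F(3) show ?thesis using S.prod_quadratics[of "\<lambda>c. [:rep c:]" F] by blast
  qed
  with v show "[:v:] - (\<Prod>(c, d)\<in>UNIV. F\<^sup>2 + [:rep c:] * F + [:rep d:]) \<in> integral_mod V \<chi>"
    by (rule S.diff[OF polys_in_integral_mod[OF const_in_polys]])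
qed

lemma const_in_Int_mat: "c \<in> V \<Longrightarrow> [:c:] \<in> Int_mat V n"
  by (intro in_Int_mat_if_integral_mod) auto

text \<open>Let \<open>Q(T)\<close> be the product of all \<open>T\<^sup>2 + c T + d\<close> with \<open>c, d\<close> representatives of residue
  classes. Then \<open>Q(F)\<close> is integer-valued on matrices, so \<open>F\<close> is a root of the monic polynomial
  \<open>Q(T) - Q(F)\<close>.\<close>

lemma F_integral: "to_fract F \<in> integral_closure (to_fract ` Int_mat V n)"
proof -
  let ?c = "\<lambda>c. to_fract [:rep c:]"
  define G where "G = (\<Prod>(c, d)\<in>UNIV. F\<^sup>2 + [:rep c:] * F + [:rep d:])"
  define Q where "Q = (\<Prod>(c, d)\<in>UNIV. [:?c d, ?c c, 1:])"
  define P where "P = Q - [:to_fract G:]"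
  interpret C: field_subring "(\<lambda>c. to_fract [:c:]) ` V"
  proof
    show "1 \<in> (\<lambda>c. to_fract [:c:]) ` V" using one by (force simp flip: one_pCons)
  next
    fix x y assume "x \<in> (\<lambda>c. to_fract [:c:]) ` V" "y \<in> (\<lambda>c. to_fract [:c:]) ` V"
    then obtain a b where *: "x = to_fract [:a:]" "y = to_fract [:b:]" "a \<in> V" "b \<in> V" by blast
    show "x - y \<in> (\<lambda>c. to_fract [:c:]) ` V"
      using * by (intro image_eqI[of _ _ "a - b"] diff) (simp_all flip: to_fract_diff)
    show "x * y \<in> (\<lambda>c. to_fract [:c:]) ` V"
      using * by (intro image_eqI[of _ _ "a * b"] mult) (simp_all flip: to_fract_mult)
  qed
  have Q: "Q \<in> polys_over ((\<lambda>c. to_fract [:c:]) ` V)"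
    unfolding Q_def by (intro C.polys.prod) (auto simp: C.pCons_in_polys_iff)
  have Q_coeff: "\<exists>v\<in>V. coeff Q i = to_fract [:v:]" for i
    using Q by (auto simp: polys_over_def)
  have monic_Q: "lead_coeff Q = 1"
    unfolding Q_def by (simp add: lead_coeff_prod split_def)
  have "degree Q = (\<Sum>x\<in>(UNIV :: ('f \<times> 'f) set). 2)"
    unfolding Q_def split_def by (subst degree_prod_eq_sum_degree) auto
  then have deg_Q: "degree Q > 0" by simp
  \<comment> \<open>Subtracting the constant \<open>Q(F)\<close> from \<open>Q\<close> affects neither the degree nor the leading
    coefficient.\<close>
  have "degree P = degree Q"
    unfolding P_def diff_conv_add_uminus using deg_Q by (intro degree_add_eq_left) simp
  then have monic: "lead_coeff P = 1"
    using monic_Q deg_Q by (simp add: P_def coeff_pCons split: nat.split)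
  have "coeff P i \<in> to_fract ` Int_mat V n" for i
  proof (cases i)
    case 0
    obtain v where v: "v \<in> V" "coeff Q 0 = to_fract [:v:]" using Q_coeff by blast
    have "coeff P i = to_fract ([:v:] - G)" using v 0 by (simp add: P_def)
    moreover have "[:v:] - G \<in> Int_mat V n"
      unfolding G_def using v(1) by (rule const_diff_prod_quadratics_in_Int_mat)
    ultimately show ?thesis by blast
  next
    case (Suc j)
    obtain v where v: "v \<in> V" "coeff Q i = to_fract [:v:]" using Q_coeff by blast
    then show ?thesis using const_in_Int_mat[OF v(1)] Suc by (simp add: P_def)
  qed
  moreover have "poly P (to_fract F) = 0"
  proof -
    have "poly [:?c d, ?c c, 1:] (to_fract F) = to_fract (F\<^sup>2 + [:rep c:] * F + [:rep d:])" for c d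
      unfolding to_fract_add to_fract_mult power2_eq_square by (simp add: algebra_simps)
    then have "poly Q (to_fract F) = to_fract G"
      unfolding Q_def G_def poly_prod to_fract_prod split_def by (intro prod.cong) simp_all
    then show ?thesis by (simp add: P_def)
  qed
  ultimately show ?thesis using monic unfolding integral_closure_def by blast
qed

text \<open>Since \<open>F\<close> vanishes to order at least \<open>n - 1\<close> at the representative \<open>c\<close> of \<open>0\<close>, its Taylor
  coefficient of that order at \<open>c\<close> is easy to compute: each of the \<open>q - 1\<close> factors
  \<open>(x - c)\<^sup>n + \<pi> a\<close> contributes only one \<open>\<pi>\<close>, and all remaining factors are units there, so it
  is a unit divided by \<open>\<pi>\<close>.\<close>

lemma F_not_in_Int_mat: "F \<notin> Int_mat V n"
proof
  assume F: "F \<in> Int_mat V n"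
  let ?h = "\<lambda>b. lin b ^ (n - 1) * (\<Prod>a\<in>UNIV - {0}. eisen b a)"
  define c where "c = rep 0"
  define k where "k = card (UNIV - {0 :: 'f})"
  define W where "W = (\<Prod>b\<in>UNIV - {0}. ?h b) * \<theta> ^ CARD('f)"
  define R where "R = (\<Prod>a\<in>UNIV - {0}. eisen 0 a) * W"
  define e where "e = (\<Prod>a\<in>UNIV - {0}. rep a) * poly W c"
  have c: "c \<in> V" by (simp add: c_def)
  have zero_pow: "(0 :: 'k) ^ n = 0" using n by (intro zero_power) simp
  have "(\<Prod>b\<in>UNIV. ?h b) = ?h 0 * (\<Prod>b\<in>UNIV - {0}. ?h b)"
    by (rule prod.remove) auto
  then have "F = [:1 / \<pi>:] ^ CARD('f) * (lin 0 ^ (n - 1) * R)"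
    unfolding F_factored W_def R_def by (simp only: mult.assoc)
  then have "pcompose F [:c, 1:] = smult ((1 / \<pi>) ^ CARD('f)) (monom 1 (n - 1) * pcompose R [:c, 1:])"
    by (simp add: c_def poly_const_pow pcompose_smult pcompose_mult pcompose_power pcompose_pCons monom_altdef)
  then have "coeff (pcompose F [:c, 1:]) (n - 1) = (1 / \<pi>) ^ CARD('f) * poly R c"
    by (simp add: coeff_monom_mult pcompose_coeff_0)
  also have "poly R c = (\<Prod>a\<in>UNIV - {0}. \<pi> * rep a) * poly W c"
    by (simp add: R_def poly_prod c_def zero_pow)
  also have "(1 / \<pi>) ^ CARD('f) * \<dots> = e / \<pi>"
    unfolding card_residue_field e_def prod.distrib prod_constant k_def[symmetric]
    using pi_nz by (simp add: power_one_over)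
  finally have "e / \<pi> \<in> V" using Int_mat_taylor_coeff[OF F c, of "n - 1"] n by simp
  have W: "W \<in> polys_over V"
    unfolding W_def using lin_in_polys eis_in_polys theta_in_polys
    by (intro polys.mult polys.prod polys.power)
  have e: "e \<in> V" unfolding e_def using W c by (intro mult prod poly_closed) auto
  have "res e = (\<Prod>a\<in>UNIV - {0}. a) * poly (reduce W) 0"
    unfolding e_def using W c by (simp add: res_mult res_prod prod poly_closed res_poly c_def)
  also have "poly (reduce W) 0 = (\<Prod>b\<in>UNIV - {0}. (- b) ^ (n - 1) * (\<Prod>a\<in>UNIV - {0 :: 'f}. (- b) ^ n))
      * poly (reduce \<theta>) 0 ^ CARD('f)"
    unfolding W_def using lin_in_polys eis_in_polys theta_in_polys
    by (simp add: reduce_mult reduce_prod reduce_power res_uminus reduce_eis poly_prod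
        polys.mult polys.prod polys.power)
  \<comment> \<open>If the coefficient were in \<open>V\<close>, then \<open>e\<close> would reduce to 0, which only \<open>\<theta>\<close> could cause; but
    an irreducible polynomial of degree at least 2 has no root.\<close>
  finally have "poly (reduce \<theta>) 0 = 0"
    using \<open>e / \<pi> \<in> V\<close> res_eq_0_iff[OF e] by auto
  then have "\<exists>f\<in>irreds n. poly (f :: 'f poly) 0 = 0"
    by (auto simp: reduce_theta poly_prod finite_irreds)
  then obtain f :: "'f poly" where f: "f \<in> irreds n" "poly f 0 = 0" by blast
  then obtain g where g: "f = [:0, 1:] * g" using poly_eq_0_iff_dvd[of f 0] by auto
  then have "g dvd 1" using f(1) Factorial_Ring.irreducibleD[of f "[:0, 1:]" g]
    by (auto simp: irreds_def is_unit_iff_degree)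
  then have "degree f \<le> 1" using g degree_mult_le[of "[:0, 1:]" g] by (auto simp: is_unit_iff_degree)
  then show False using f(1) by (auto simp: irreds_def)
qed

end

theorem theorem2p2:
  fixes V :: "'k::field set" and \<pi> :: 'k
    and res :: "'k \<Rightarrow> 'f::{finite,field}"
    and rep :: "'f \<Rightarrow> 'k"
    and lft :: "'f poly \<Rightarrow> 'k poly"
    and n :: nat
  assumes "dvr_with_fraction_field V \<pi>"
    and "residue_map V \<pi> res"
    and "n \<ge> 2"
    and "representatives V res rep"
    and "monic_lifts V res n lft"
  shows "properly_integral V n (F_poly n \<pi> rep lft)"
proof -
  have sub: "subring V class_ring" and pi: "\<pi> \<in> V" "\<pi> \<noteq> 0"
    using assms(1) by (auto simp: dvr_with_fraction_field_def)
  have hom: "res \<in> Ring.ring_hom (ring_on V) class_ring"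
    and ker: "{v \<in> V. res v = 0} = {w * \<pi> | w. w \<in> V}"
    using assms(2) by (auto simp: residue_map_def cgenideal_def)
  have uminus: "- x \<in> V" if "x \<in> V" for x
    using subringE(5)[OF sub that] by (simp add: class_ring_simps)
  interpret lifted_construction V \<pi> res rep n lft
  proof
    show "1 \<in> V" using subringE(3)[OF sub] by simp
    show "x * y \<in> V" if "x \<in> V" "y \<in> V" for x y
      using subringE(6)[OF sub that] by simp
    show "x - y \<in> V" if "x \<in> V" "y \<in> V" for x y
      using subringE(7)[OF sub that(1) uminus[OF that(2)]] by simp
    show "res (x + y) = res x + res y" "res (x * y) = res x * res y" if "x \<in> V" "y \<in> V" for x y
      using ring_hom_add[OF hom, of x y] ring_hom_mult[OF hom, of x y] that by simp_all
    show "res 1 = 1" using ring_hom_one[OF hom] by simp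
    show "res x = 0 \<longleftrightarrow> x / \<pi> \<in> V" if "x \<in> V" for x
    proof -
      have "res x = 0 \<longleftrightarrow> (\<exists>w\<in>V. x = w * \<pi>)" using ker that by blast
      also have "\<dots> \<longleftrightarrow> x / \<pi> \<in> V" using pi by (auto simp: field_simps intro!: bexI[of _ "x / \<pi>"])
      finally show ?thesis .
    qed
  qed (use assms pi in \<open>auto simp: representatives_def\<close>)
  show ?thesis
    unfolding properly_integral_def using F_integral F_not_in_Int_mat by blast
qed

end
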